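(* Let $I=\{B_1,\ldots,B_n\}$ be any information structure and let $L(I)=\{G_1,\ldots,G_n\}$, with the labeling chosen so that $c(G_1)<\cdots<c(G_n)$. Suppose that $C\in\varphi^P(I)$. Then: (i) $C=\{(c(G_1),\mathbb{E}_{\lambda_{G_1}}(X)),\ldots,(c(G_n),\mathbb{E}_{\lambda_{G_n}}(X))\}$, where $\lambda_{G_i}(A)=\phi(A\cap G_i)/\phi(G_i)$ for every measurable set $A$. (ii) $\{(c(G_n),\mathbb{E}_{\lambda_{G_n}}(X))\}\in\varphi^P(\{B_n\})$. (iii) Suppose that $I_o$ is implementable and $C_o\in\varphi^P(I_o)$. Then $\mathcal{C}^P=2^{C_o}$, where $2^{C_o}$ denotes the set of all nonempty subsets of $C_o$.
   Context: Sellers and information. Sellers' quality levels lie in $X=[0,\overline{x}]$, $\overline{x}>0$, distributed according to a Borel probability measure $\phi$ on $X$. The platform's information is a finite measurable partition $I_o=\{A_1,\ldots,A_l\}$ of $X$ with $\phi(A_i)>0$. An information structure is a nonempty family $I=\{B_1,\ldots,B_n\}$ of pairwise disjoint nonempty sets, each a union of elements of $I_o$. For $I=\{B_1,\ldots,B_n\}$, $L(I)=\{G_1,\ldots,G_n\}$, where $G_j\in I_o$ is the element $A_k$ of lowest index $k$ among those contained in $B_j$. Sellers have a positive marginal cost $c(x)$, constant on each $A_i$ with value $c(A_i)$, and $c(A_i)<c(A_j)$ for $i<j$. Buyers. Types $m$ are distributed according to a continuous cumulative distribution function $F$ supported on $[a,b]\subseteq[0,\infty)$, $a<b$ ($F$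 strictly increasing on $[a,b]$). With beliefs $\lambda_{B_i}$ about quality in $B_i$ (mean $\mathbb{E}_{\lambda_{B_i}}(X)$) and $p(B_i)$ the lowest price in $B_i$, a type $m$ buyer's utility from buying in $B_i$ is $Z(m,B_i,p(B_i))=m\,\mathbb{E}_{\lambda_{B_i}}(X)-p(B_i)$, and $0$ from not buying. With $\boldsymbol{p}=(p(B_1),\ldots,p(B_n))$, the demand for $B_i$ is $D_I(B_i,\boldsymbol{p})=\int_a^b1\{Z(m,B_i,p(B_i))\ge0\}1\{Z(m,B_i,p(B_i))=\max_{B\in I}Z(m,B,p(B))\}F(dm)$. Sellers' game. Let $H(B_i)\subseteq B_i$ be the set of participating sellers and $M_I(B_i,\boldsymbol{p})$ the mass of sellers in $B_i$ charging $p(B_i)$. If the other sellers in $H(B_i)$ charge $p(B_i)$, a participating seller $x\in B_i$ charging $p_x\ge0$ sells quantity $h_I(B_i,H(B_i),p_x,\boldsymbol{p})$ equal to $\infty$ if $p_x<p(B_i)$ and $D_I(B_i,\boldsymbol{p})>0$; $D_I(B_i,\boldsymbol{p})/M_I(B_i,\boldsymbol{p})$ if $p_x=p(B_i)$ and $D_I(B_i,\boldsymbol{p})>0$ (interpreted as $\infty$ if $M_I(B_i,\boldsymbol p)=0$); and $0$ if $p_x>p(B_i)$ or $D_I(B_i,\boldsymbol{p})=0$. The seller's utility is $\overline{U}(x,H(B_i),p_x,\boldsymbol{p})=h_I(B_i,H(B_i),p_x,\boldsymbol{p})(p_x-c(x))$ (with $\infty\cdot0=0$); not participating gives $0$. Equilibrium.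 For $I$, a (symmetric) equilibrium consists of positive prices $\boldsymbol{p}=(p(B_1),\ldots,p(B_n))$ (all participating sellers in $B_i$ charge $p(B_i)$), positive masses $M_I(B_i,\boldsymbol{p})=\phi(H(B_i))$, positive demands $D_I(B_i,\boldsymbol{p})$, and beliefs $\lambda_{B_i}$ such that: (1) $p(B_i)$ is a maximizer of $p_x\mapsto\overline{U}(x,H(B_i),p_x,\boldsymbol{p})$ over $p_x\ge0$ for each $x\in H(B_i)$, and $x\in B_i$ belongs to $H(B_i)$ if and only if $\overline{U}(x,H(B_i),p(B_i),\boldsymbol{p})\ge0$; (2) buyers' decisions are optimal, as reflected in $D_I$; (3) $\lambda_{B_i}(A)=\phi(A\cap H(B_i))/\phi(H(B_i))$ for every measurable $A$; (4) $M_I(B_i,\boldsymbol{p})\,h_I(B_i,H(B_i),p(B_i),\boldsymbol{p})=D_I(B_i,\boldsymbol{p})$ for all $B_i\in I$. $I$ is implementable if an equilibrium under $I$ exists. An equilibrium under $I$ induces the menu $\{(p(B_i),\mathbb{E}_{\lambda_{B_i}}(X)):B_i\in I\}$; $\varphi^P(I)$ is the set of menus induced by equilibria under $I$, and $\mathcal{C}^P$ is the set of all menus induced by some implementable information structure. *)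

theory Defs
  imports "HOL-Probability.Probability"
begin

definition cell_cost :: "(real \<Rightarrow> real) \<Rightarrow> real set \<Rightarrow> real" where
  "cell_cost c S = the_elem (c ` S)"

definition mean_quality :: "real measure \<Rightarrow> real" where
  "mean_quality Q = prob_space.expectation Q (\<lambda>x. x)"

definition buyer_utility ::
    "(real set \<Rightarrow> real measure) \<Rightarrow> real \<Rightarrow> real set \<Rightarrow> real \<Rightarrow> real" where
  "buyer_utility bel m B q = m * mean_quality (bel B) - q"

text \<open>
  The argument \<open>D\<close> is the demand for the group of sellers, \<open>M\<close> the mass of sellers in
  the group that charge the group's price \<open>pB\<close>, and \<open>q\<close> the price of an individual seller.
\<close>

definition quantity_sold :: "real \<Rightarrow> real \<Rightarrow> real \<Rightarrow> real \<Rightarrow> ereal" where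
  "quantity_sold D M pB q =
     (if D > 0 \<and> q < pB then \<infinity>
      else if D > 0 \<and> q = pB then (if M = 0 then \<infinity> else ereal (D / M))
      else 0)"

locale market =
  fixes xbar :: real
    and \<phi> :: "real measure"
    and l :: nat
    and A :: "nat \<Rightarrow> real set"
    and c :: "real \<Rightarrow> real"
    and a b :: real
    and F :: "real \<Rightarrow> real"
  assumes xbar_pos: "0 < xbar"
    and prob_quality: "prob_space \<phi>"
    and sets_quality: "sets \<phi> = sets (restrict_space borel {0..xbar})"
    and cells_measurable: "\<And>i. i \<in> {1..l} \<Longrightarrow> A i \<in> sets \<phi>"
    and cells_disjoint: "disjoint_family_on A {1..l}"
    and cells_cover: "(\<Union>i\<in>{1..l}. A i) = {0..xbar}"
    and cells_mass_pos: "\<And>i. i \<in> {1..l} \<Longrightarrow> measure \<phi> (A i) > 0"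
    and cost_pos: "\<And>x. x \<in> {0..xbar} \<Longrightarrow> c x > 0"
    and cost_constant: "\<And>i. i \<in> {1..l} \<Longrightarrow> c constant_on A i"
    and cost_increasing: "strict_mono_on {1..l} (\<lambda>i. cell_cost c (A i))"
    and types_nonneg: "0 \<le> a"
    and types_nondegenerate: "a < b"
    and cdf_continuous: "continuous_on UNIV F"
    and cdf_strict: "strict_mono_on {a..b} F"
    and cdf_below: "\<And>m. m \<le> a \<Longrightarrow> F m = 0"
    and cdf_above: "\<And>m. b \<le> m \<Longrightarrow> F m = 1"
begin

definition platform_info :: "real set set" where
  "platform_info = A ` {1..l}"

definition information_structure :: "real set set \<Rightarrow> bool" where
  "information_structure I \<longleftrightarrow>
     I \<noteq> {} \<and> disjoint I \<and> (\<forall>B\<in>I. B \<noteq> {} \<and> (\<exists>S\<subseteq>platform_info. B = \<Union>S))"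

definition lowest_cell :: "real set \<Rightarrow> real set" where
  "lowest_cell B = A (LEAST k. k \<in> {1..l} \<and> A k \<subseteq> B)"

text \<open>
  Beliefs, prices and participation assign a distribution on qualities, a price and a set of
  sellers to each element of an information structure; their values elsewhere are irrelevant.
\<close>

definition demand ::
    "real set set \<Rightarrow> (real set \<Rightarrow> real measure) \<Rightarrow> (real set \<Rightarrow> real) \<Rightarrow> real set \<Rightarrow> real" where
  "demand I bel p B =
     (LINT m:{a..b}|interval_measure F.
        of_bool (buyer_utility bel m B (p B) \<ge> 0) *
        of_bool (buyer_utility bel m B (p B) = (MAX B'\<in>I. buyer_utility bel m B' (p B'))))"

text \<open>In \<^typ>\<open>ereal\<close>, \<open>\<infinity> * 0 = 0\<close>.\<close>

definition seller_utility :: "real \<Rightarrow> real \<Rightarrow> real \<Rightarrow> real \<Rightarrow> real \<Rightarrow> ereal" where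
  "seller_utility D M pB x q = quantity_sold D M pB q * ereal (q - c x)"

definition posterior :: "real set \<Rightarrow> real measure \<Rightarrow> bool" where
  "posterior S Q \<longleftrightarrow> prob_space Q \<and> sets Q = sets \<phi> \<and>
     (\<forall>T\<in>sets \<phi>. measure Q T = measure \<phi> (T \<inter> S) / measure \<phi> S)"

definition equilibrium ::
    "real set set \<Rightarrow> (real set \<Rightarrow> real) \<Rightarrow> (real set \<Rightarrow> real set) \<Rightarrow>
     (real set \<Rightarrow> real measure) \<Rightarrow> bool" where
  "equilibrium I p H bel \<longleftrightarrow>
     (\<forall>B\<in>I.
        let D = demand I bel p B; M = measure \<phi> (H B) in
        H B \<subseteq> B \<and> H B \<in> sets \<phi> \<and> p B > 0 \<and> M > 0 \<and> D > 0 \<and>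
        (\<forall>x\<in>H B. \<forall>q\<ge>0. seller_utility D M (p B) x q \<le> seller_utility D M (p B) x (p B)) \<and>
        (\<forall>x\<in>B. x \<in> H B \<longleftrightarrow> seller_utility D M (p B) x (p B) \<ge> 0) \<and>
        posterior (H B) (bel B) \<and>
        ereal M * quantity_sold D M (p B) (p B) = ereal D)"

definition implementable :: "real set set \<Rightarrow> bool" where
  "implementable I \<longleftrightarrow> (\<exists>p H bel. equilibrium I p H bel)"

definition menus :: "real set set \<Rightarrow> (real \<times> real) set set" where
  "menus I = {(\<lambda>B. (p B, mean_quality (bel B))) ` I | p H bel. equilibrium I p H bel}"

definition all_menus :: "(real \<times> real) set set" where
  "all_menus = \<Union>{menus I | I. information_structure I \<and> implementable I}"

lemma posterior_iff_uniform_measure: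
  assumes "S \<in> sets \<phi>" "measure \<phi> S > 0"
  shows "posterior S Q \<longleftrightarrow> Q = uniform_measure \<phi> S"
proof -
  interpret prob_space \<phi> by (rule prob_quality)
  have nz: "emeasure \<phi> S \<noteq> 0" "emeasure \<phi> S \<noteq> \<infinity>"
    using assms by (auto simp: measure_def)
  have meas: "measure (uniform_measure \<phi> S) T = measure \<phi> (T \<inter> S) / measure \<phi> S"
    if "T \<in> sets \<phi>" for T
    using measure_uniform_measure[OF nz that] by (simp add: Int_commute)
  have unif: "posterior S (uniform_measure \<phi> S)"
    using prob_space_uniform_measure[OF nz] meas by (simp add: posterior_def)
  moreover have "Q = uniform_measure \<phi> S" if Q: "posterior S Q"
  proof (rule measure_eqI)
    show "sets Q = sets (uniform_measure \<phi> S)"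
      using Q by (simp add: posterior_def)
  next
    fix T assume "T \<in> sets Q"
    then have T: "T \<in> sets \<phi>" using Q by (simp add: posterior_def)
    interpret Q: prob_space Q using Q by (simp add: posterior_def)
    interpret U: prob_space "uniform_measure \<phi> S" by (rule prob_space_uniform_measure[OF nz])
    show "emeasure Q T = emeasure (uniform_measure \<phi> S) T"
      using Q T meas[OF T] by (simp add: posterior_def Q.emeasure_eq_measure U.emeasure_eq_measure)
  qed
  ultimately show ?thesis by blast
qed

end

end

(* A seller who strictly profits at the group's price would undercut it and sell an infinite
   quantity, while every seller whose cost is at most that price participates.  Hence the price is
   the lowest cost in the group, the participants are exactly the lowest cell, and the beliefs are
   forced.  So an information structure has at most one equilibrium menu, and it is implementable
   iff the demands at that menu are all positive.  Removing offers from a menu only raises the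
   demand for the remaining ones, so every submenu of an equilibrium menu remains one. *)
theory Submission
  imports Defs
begin

context market
begin

section \<open>Buyer types and monotonicity of demand\<close>

lemma prob_space_buyer_types: "prob_space (interval_measure F)"
proof -
  have mono: "F x \<le> F y" if "x \<le> y" for x y
  proof -
    \<comment> \<open>Strict monotonicity is given on \<open>{a..b}\<close> only; outside it
      \<open>F\<close> is constantly 0 or 1, so the remaining cases need just the bounds 0 and
      1.\<close>
    have inner: "F u \<le> F v" if "a \<le> u" "u \<le> v" "v \<le> b" for u v
      using strict_mono_on_leD[OF cdf_strict, of u v] that by auto
    have Fb: "F b = 1" and Fa: "F a = 0" using cdf_above cdf_below by auto
    have range: "0 \<le> F u \<and> F u \<le> 1" for u
      using inner[of a u] inner[of u b] cdf_below[of u] cdf_above[of u] Fa Fb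
      by (cases "u \<le> a"; cases "b \<le> u") auto
    show ?thesis
      using inner[of x y] range[of x] range[of y] cdf_below[of x] cdf_above[of y] that
      by (cases "x \<le> a"; cases "b \<le> y") auto
  qed
  have right: "continuous (at_right x) F" for x
    using cdf_continuous by (simp add: continuous_on_eq_continuous_at continuous_at_imp_continuous_within)
  have bot: "(F \<longlongrightarrow> 0) at_bot"
    by (rule tendsto_eventually) (use cdf_below in \<open>auto simp: eventually_at_bot_linorder\<close>)
  have top: "(F \<longlongrightarrow> 1) at_top"
    by (rule tendsto_eventually) (use cdf_above in \<open>auto simp: eventually_at_top_linorder\<close>)
  show ?thesis
    using real_distribution_interval_measure[OF mono right bot top]
    by (simp add: real_distribution_def)
qed

text \<open>Finiteness of \<open>I\<close> makes the maximum of the affine utilities measurable, and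
  a measurable integrand bounded by 1 is integrable for a probability measure.\<close>

lemma integrable_demand:
  assumes "finite I"
  shows "set_integrable (interval_measure F) {a..b}
    (\<lambda>m. of_bool (buyer_utility bel m B (p B) \<ge> 0) *
      of_bool (buyer_utility bel m B (p B) = (MAX B'\<in>I. buyer_utility bel m B' (p B'))) :: real)"
proof -
  interpret prob_space "interval_measure F" by (rule prob_space_buyer_types)
  have [measurable]: "(\<lambda>m. MAX B'\<in>I. buyer_utility bel m B' (p B')) \<in> borel_measurable borel"
    unfolding buyer_utility_def by (rule borel_measurable_Max) (use assms in auto)
  have [measurable]: "(\<lambda>m. buyer_utility bel m B (p B)) \<in> borel_measurable borel"
    unfolding buyer_utility_def by measurable
  show ?thesis unfolding set_integrable_def
    by (rule integrable_const_bound[where B = 1]) (auto simp: indicator_def)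
qed

text \<open>A type whose best offer is that of \<open>B\<close> still finds it best in a smaller
  menu, so the integrands compare pointwise. Only offers are compared: \<open>J\<close> may consist
  of groups other than those of \<open>I\<close>.\<close>

lemma demand_mono:
  assumes "finite I" "finite J" "B' \<in> J"
    and sub: "(\<lambda>B. (p' B, mean_quality (bel' B))) ` J \<subseteq> (\<lambda>B. (p B, mean_quality (bel B))) ` I"
    and same: "p' B' = p B" "mean_quality (bel' B') = mean_quality (bel B)"
  shows "demand I bel p B \<le> demand J bel' p' B'"
  unfolding demand_def
proof (rule set_integral_mono[OF integrable_demand integrable_demand])
  fix m
  let ?U = "\<lambda>B. buyer_utility bel m B (p B)" and ?V = "\<lambda>B. buyer_utility bel' m B (p' B)"
  have eq: "?V B' = ?U B" using same by (simp add: buyer_utility_def)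
  have "?V B' = Max (?V ` J)" if max: "?U B = Max (?U ` I)"
  proof (rule Max_eqI[symmetric])
    fix y assume "y \<in> ?V ` J"
    then obtain D where D: "D \<in> J" "y = ?V D" by blast
    have "(p' D, mean_quality (bel' D)) \<in> (\<lambda>B. (p B, mean_quality (bel B))) ` I"
      using sub D by blast
    then obtain E where "E \<in> I" "p' D = p E" "mean_quality (bel' D) = mean_quality (bel E)"
      by auto
    with D have "y = ?U E" "E \<in> I" by (simp_all add: buyer_utility_def)
    then show "y \<le> ?V B'" using assms(1) max eq by simp
  next
    show "?V B' \<in> ?V ` J" using assms(3) by (rule imageI)
  qed (use assms in auto)
  with eq show "of_bool (?U B \<ge> 0) * of_bool (?U B = Max (?U ` I))
      \<le> (of_bool (?V B' \<ge> 0) * of_bool (?V B' = Max (?V ` J)) :: real)"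
    by auto
qed (use assms in auto)

section \<open>Cells and the lowest cell of a group\<close>

lemma cell_nonempty: "i \<in> {1..l} \<Longrightarrow> A i \<noteq> {}"
  using cells_mass_pos by fastforce

lemma cell_cost_eq:
  assumes "i \<in> {1..l}" "x \<in> A i"
  shows "cell_cost c (A i) = c x"
proof -
  have "c ` A i = {c x}"
    using cost_constant[OF assms(1)] assms(2) by (auto simp: constant_on_def)
  then show ?thesis by (simp add: cell_cost_def)
qed

text \<open>The condition that \<open>information_structure\<close> puts on each single group, kept
  apart from disjointness so that groups can be treated one at a time.\<close>

definition cell_union :: "real set \<Rightarrow> bool" where
  "cell_union B \<longleftrightarrow> B \<noteq> {} \<and> (\<exists>S\<subseteq>platform_info. B = \<Union>S)"

text \<open>A nonempty union of cells contains a cell, so the \<open>LEAST\<close> in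
  \<open>lowest_cell\<close> is attained. Each point of \<open>B\<close> lies in a cell inside
  \<open>B\<close>, and minimality bounds the index of that cell from below.\<close>

lemma lowest_cellE:
  assumes "cell_union B"
  obtains k where "k \<in> {1..l}" "lowest_cell B = A k" "A k \<subseteq> B"
    "\<And>x. x \<in> B \<Longrightarrow> \<exists>i\<in>{1..l}. k \<le> i \<and> x \<in> A i"
proof -
  define k where "k = (LEAST k. k \<in> {1..l} \<and> A k \<subseteq> B)"
  have cover: "\<exists>i. (i \<in> {1..l} \<and> A i \<subseteq> B) \<and> x \<in> A i" if "x \<in> B" for x
    using assms that unfolding cell_union_def platform_info_def by blast
  obtain x where "x \<in> B" using assms by (auto simp: cell_union_def)
  then obtain i where "i \<in> {1..l} \<and> A i \<subseteq> B" using cover by blast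
  then have k: "k \<in> {1..l} \<and> A k \<subseteq> B" unfolding k_def by (rule LeastI)
  have low: "k \<le> i" if "i \<in> {1..l} \<and> A i \<subseteq> B" for i
    unfolding k_def using that by (rule Least_le)
  show thesis
  proof (rule that)
    show "k \<in> {1..l}" "A k \<subseteq> B" using k by auto
    show "lowest_cell B = A k" by (simp add: lowest_cell_def k_def)
    show "\<exists>i\<in>{1..l}. k \<le> i \<and> x \<in> A i" if "x \<in> B" for x
      using cover[OF that] low by blast
  qed
qed

lemma lowest_cell_mem: "cell_union B \<Longrightarrow> lowest_cell B \<in> platform_info"
  by (erule lowest_cellE) (auto simp: platform_info_def)

lemma cell_union_cell: "i \<in> {1..l} \<Longrightarrow> cell_union (A i)"
  unfolding cell_union_def platform_info_def
  using cell_nonempty by (auto intro!: exI[of _ "{A i}"])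

text \<open>Cells are disjoint and nonempty, so the only cell inside \<open>A i\<close> is
  \<open>A i\<close> itself.\<close>

lemma lowest_cell_cell:
  assumes "i \<in> {1..l}"
  shows "lowest_cell (A i) = A i"
proof -
  obtain k where k: "k \<in> {1..l}" "lowest_cell (A i) = A k" "A k \<subseteq> A i"
    using lowest_cellE[OF cell_union_cell[OF assms]] by metis
  then have "k = i"
    using cells_disjoint cell_nonempty[of k] assms unfolding disjoint_family_on_def by blast
  with k show ?thesis by simp
qed

definition lowest_cost :: "real set \<Rightarrow> real" where
  "lowest_cost B = cell_cost c (lowest_cell B)"

text \<open>This is \<phi> conditioned on the lowest cell.\<close>

definition lowest_belief :: "real set \<Rightarrow> real measure" where
  "lowest_belief B = uniform_measure \<phi> (lowest_cell B)"

definition lowest_offer :: "real set \<Rightarrow> real \<times> real" where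
  "lowest_offer B = (lowest_cost B, mean_quality (lowest_belief B))"

text \<open>Costs strictly increase with the cell index, and every seller of \<open>B\<close> sits
  in a cell of index at least that of the lowest one; a cost not above the minimum thus forces equal
  indices.\<close>

lemma cost_le_lowest_cost_iff:
  assumes "cell_union B" "x \<in> B"
  shows "lowest_cost B \<le> c x" "c x \<le> lowest_cost B \<longleftrightarrow> x \<in> lowest_cell B"
proof -
  obtain k where k: "k \<in> {1..l}" "lowest_cell B = A k" "A k \<subseteq> B"
      "\<And>x. x \<in> B \<Longrightarrow> \<exists>i\<in>{1..l}. k \<le> i \<and> x \<in> A i"
    using lowest_cellE[OF assms(1)] by metis
  obtain i where i: "i \<in> {1..l}" "k \<le> i" "x \<in> A i" using k(4) assms(2) by blast
  have ci: "cell_cost c (A i) = c x" using cell_cost_eq i by blast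
  have less: "lowest_cost B < c x" if "k \<noteq> i"
    using strict_mono_onD[OF cost_increasing k(1) i(1)] that i(2) k(2) ci
    by (simp add: lowest_cost_def)
  have eq: "lowest_cost B = c x" if "x \<in> A k"
    using cell_cost_eq[OF k(1) that] k(2) by (simp add: lowest_cost_def)
  show "lowest_cost B \<le> c x" "c x \<le> lowest_cost B \<longleftrightarrow> x \<in> lowest_cell B"
    using less eq i k(2) by (cases "k = i"; force)+
qed

lemma lowest_cell_facts:
  assumes "cell_union B"
  shows "lowest_cell B \<subseteq> B" "lowest_cell B \<in> sets \<phi>" "measure \<phi> (lowest_cell B) > 0"
    "lowest_cost B > 0"
proof -
  obtain k where k: "k \<in> {1..l}" "lowest_cell B = A k" "A k \<subseteq> B"
    using lowest_cellE[OF assms] by metis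
  obtain x where "x \<in> A k" using cell_nonempty[OF k(1)] by blast
  moreover then have "x \<in> {0..xbar}" using cells_cover k(1) by blast
  ultimately show "lowest_cost B > 0"
    using cell_cost_eq[OF k(1)] cost_pos k(2) by (simp add: lowest_cost_def)
  show "lowest_cell B \<subseteq> B" "lowest_cell B \<in> sets \<phi>" "measure \<phi> (lowest_cell B) > 0"
    using k cells_measurable cells_mass_pos by auto
qed

section \<open>Characterization of equilibria\<close>

lemma seller_utility_group_price:
  "D > 0 \<Longrightarrow> M > 0 \<Longrightarrow> seller_utility D M q x q = ereal (D / M * (q - c x))"
  by (simp add: seller_utility_def quantity_sold_def)

text \<open>Positive demand is the one condition not settled by the lowest cells, which reduces
  existence of equilibria to comparing demands.\<close>

lemma equilibrium_iff:
  assumes "\<And>B. B \<in> I \<Longrightarrow> cell_union B"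
  shows "equilibrium I p H bel \<longleftrightarrow>
    (\<forall>B\<in>I. p B = lowest_cost B \<and> H B = lowest_cell B \<and> bel B = lowest_belief B \<and>
       demand I bel p B > 0)"
proof
  assume eq: "equilibrium I p H bel"
  show "\<forall>B\<in>I. p B = lowest_cost B \<and> H B = lowest_cell B \<and> bel B = lowest_belief B \<and>
       demand I bel p B > 0"
  proof
    fix B assume B: "B \<in> I"
    let ?D = "demand I bel p B" and ?M = "measure \<phi> (H B)"
    have H: "H B \<subseteq> B" "H B \<in> sets \<phi>" and pos: "p B > 0" "?M > 0" "?D > 0"
      and opt: "\<And>x q. x \<in> H B \<Longrightarrow> q \<ge> 0 \<Longrightarrow>
        seller_utility ?D ?M (p B) x q \<le> seller_utility ?D ?M (p B) x (p B)"
      and part: "\<And>x. x \<in> B \<Longrightarrow> x \<in> H B \<longleftrightarrow> seller_utility ?D ?M (p B) x (p B) \<ge> 0"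
      and post: "posterior (H B) (bel B)"
      using eq B unfolding equilibrium_def Let_def by blast+
    have H_iff: "x \<in> H B \<longleftrightarrow> c x \<le> p B" if "x \<in> B" for x
      using part[OF that] pos by (simp add: seller_utility_group_price zero_le_mult_iff zero_le_divide_iff)
    have cost: "c x = p B" if x: "x \<in> H B" for x
    proof (rule antisym)
      show "c x \<le> p B" using H_iff H(1) x by blast
      show "p B \<le> c x"
      proof (rule ccontr)
        assume "\<not> p B \<le> c x"
        \<comment> \<open>The maximum with 0 keeps the undercutting price admissible. At
          \<open>q\<close> the margin is positive and the quantity infinite, while the utility at
          the group's price is finite.\<close>
        then obtain q where q: "max 0 (c x) < q" "q < p B"
          using pos(1) dense[of "max 0 (c x)" "p B"] by auto
        then have "seller_utility ?D ?M (p B) x q = \<infinity>"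
          using pos by (simp add: seller_utility_def quantity_sold_def)
        with opt[OF x, of q] q show False
          using pos by (simp add: seller_utility_group_price)
      qed
    qed
    \<comment> \<open>A participant \<open>x\<close> shows that the price is at least the lowest
      cost. A seller \<open>y\<close> of the lowest cell then participates, so the price equals the
      cost of \<open>y\<close>.\<close>
    obtain x where x: "x \<in> H B" using pos(2) by fastforce
    obtain y where y: "y \<in> lowest_cell B"
      using lowest_cell_facts(3)[OF assms[OF B]] by fastforce
    have low_y: "y \<in> B" "c y = lowest_cost B"
      using y lowest_cell_facts(1)[OF assms[OF B]] cost_le_lowest_cost_iff[OF assms[OF B], of y]
      by (blast, force)
    have "lowest_cost B \<le> p B"
      using cost_le_lowest_cost_iff(1)[OF assms[OF B], of x] cost[OF x] x H(1) by auto
    then have p: "p B = lowest_cost B" using H_iff[of y] cost[of y] low_y by auto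
    moreover have HB: "H B = lowest_cell B"
      using H_iff cost_le_lowest_cost_iff(2)[OF assms[OF B]] H(1) p
        lowest_cell_facts(1)[OF assms[OF B]] by auto
    moreover have "bel B = lowest_belief B"
      using posterior_iff_uniform_measure[OF H(2) pos(2)] post HB by (simp add: lowest_belief_def)
    ultimately show "p B = lowest_cost B \<and> H B = lowest_cell B \<and> bel B = lowest_belief B \<and> ?D > 0"
      using pos by simp
  qed
next
  assume canon: "\<forall>B\<in>I. p B = lowest_cost B \<and> H B = lowest_cell B \<and> bel B = lowest_belief B \<and>
       demand I bel p B > 0"
  show "equilibrium I p H bel"
    unfolding equilibrium_def Let_def
  proof
    fix B assume B: "B \<in> I"
    let ?D = "demand I bel p B" and ?M = "measure \<phi> (H B)"
    note low = lowest_cell_facts[OF assms[OF B]]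
    have eqs: "p B = lowest_cost B" "H B = lowest_cell B" "bel B = lowest_belief B" "?D > 0"
      using canon B by auto
    have M: "?M > 0" using low eqs by simp
    have "seller_utility ?D ?M (p B) x q \<le> seller_utility ?D ?M (p B) x (p B)"
      if "x \<in> H B" for x q
    proof -
      have x: "x \<in> B" "c x = p B"
        using that eqs low cost_le_lowest_cost_iff[OF assms[OF B], of x] by (blast, force)
      then have "seller_utility ?D ?M (p B) x (p B) = 0"
        using seller_utility_group_price[OF eqs(4) M] by simp
      \<comment> \<open>Since the price equals the cost of \<open>x\<close>, undercutting sells an
        infinite quantity at a loss, and a higher price sells nothing.\<close>
      moreover have "seller_utility ?D ?M (p B) x q \<le> 0"
        using x eqs M by (auto simp: seller_utility_def quantity_sold_def)
      ultimately show ?thesis by simp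
    qed
    moreover have "x \<in> H B \<longleftrightarrow> seller_utility ?D ?M (p B) x (p B) \<ge> 0" if "x \<in> B" for x
      using cost_le_lowest_cost_iff(2)[OF assms[OF B] that] eqs M
      by (simp add: seller_utility_group_price zero_le_mult_iff zero_le_divide_iff)
    moreover have "posterior (H B) (bel B)"
      using posterior_iff_uniform_measure[of "H B"] low eqs by (simp add: lowest_belief_def)
    moreover have "ereal ?M * quantity_sold ?D ?M (p B) (p B) = ereal ?D"
      using eqs(4) M by (simp add: quantity_sold_def)
    ultimately show "H B \<subseteq> B \<and> H B \<in> sets \<phi> \<and> p B > 0 \<and> ?M > 0 \<and> ?D > 0 \<and>
        (\<forall>x\<in>H B. \<forall>q\<ge>0. seller_utility ?D ?M (p B) x q \<le> seller_utility ?D ?M (p B) x (p B)) \<and>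
        (\<forall>x\<in>B. x \<in> H B \<longleftrightarrow> seller_utility ?D ?M (p B) x (p B) \<ge> 0) \<and>
        posterior (H B) (bel B) \<and>
        ereal ?M * quantity_sold ?D ?M (p B) (p B) = ereal ?D"
      using low eqs M by simp
  qed
qed

section \<open>Menus and submenus\<close>

lemma mem_menus_iff:
  assumes "finite I" and "\<And>B. B \<in> I \<Longrightarrow> cell_union B"
  shows "C \<in> menus I \<longleftrightarrow>
    C = lowest_offer ` I \<and> (\<forall>B\<in>I. demand I lowest_belief lowest_cost B > 0)"
proof
  assume "C \<in> menus I"
  then obtain p H bel where C: "C = (\<lambda>B. (p B, mean_quality (bel B))) ` I"
    and eq: "equilibrium I p H bel" by (auto simp: menus_def)
  have eqs: "p B = lowest_cost B" "bel B = lowest_belief B" "demand I bel p B > 0"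
    if "B \<in> I" for B
    using eq equilibrium_iff[OF assms(2)] that by auto
  have im: "(\<lambda>B. (p B, mean_quality (bel B))) ` I = lowest_offer ` I"
    by (rule image_cong) (simp_all add: eqs lowest_offer_def)
  \<comment> \<open>The functions \<open>p\<close> and \<open>bel\<close> are pinned down on
    \<open>I\<close> only; monotonicity of demand with \<open>J = I\<close> replaces them by the
    canonical ones.\<close>
  have "demand I lowest_belief lowest_cost B > 0" if "B \<in> I" for B
    using demand_mono[OF assms(1,1) that, where p = p and bel = bel and B = B and p' = lowest_cost
        and bel' = lowest_belief] eqs[OF that] im by (simp add: lowest_offer_def)
  with C im show "C = lowest_offer ` I \<and> (\<forall>B\<in>I. demand I lowest_belief lowest_cost B > 0)"
    by simp
next
  assume "C = lowest_offer ` I \<and> (\<forall>B\<in>I. demand I lowest_belief lowest_cost B > 0)"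
  moreover then have "equilibrium I lowest_cost lowest_cell lowest_belief"
    using equilibrium_iff[OF assms(2)] by simp
  ultimately show "C \<in> menus I"
    unfolding menus_def lowest_offer_def by blast
qed

text \<open>By \<open>demand_mono\<close>, positive demand passes from the larger menu to the
  smaller one. This yields both the singleton menu of one group and the realization of arbitrary
  submenus.\<close>

lemma submenu_mem_menus:
  assumes "finite I" "finite J" "\<And>B. B \<in> I \<Longrightarrow> cell_union B" "\<And>B. B \<in> J \<Longrightarrow> cell_union B"
    and "C \<in> menus I" "lowest_offer ` J \<subseteq> lowest_offer ` I"
  shows "lowest_offer ` J \<in> menus J"
proof -
  have "demand J lowest_belief lowest_cost B' > 0" if B': "B' \<in> J" for B'
  proof -
    obtain B where B: "B \<in> I" "lowest_offer B' = lowest_offer B" using assms(6) B' by blast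
    have "demand I lowest_belief lowest_cost B \<le> demand J lowest_belief lowest_cost B'"
      using demand_mono[OF assms(1,2) B', where p = lowest_cost and bel = lowest_belief and B = B
          and p' = lowest_cost and bel' = lowest_belief] B assms(6)
      by (simp add: lowest_offer_def)
    moreover have "demand I lowest_belief lowest_cost B > 0"
      using assms(5) mem_menus_iff[OF assms(1,3)] B by blast
    ultimately show ?thesis by simp
  qed
  then show ?thesis using mem_menus_iff[OF assms(2,4)] by blast
qed

section \<open>Information structures and the set of all menus\<close>

lemma information_structure_cell_union:
  "information_structure I \<Longrightarrow> B \<in> I \<Longrightarrow> cell_union B"
  by (auto simp: information_structure_def cell_union_def)

text \<open>Groups are unions of subfamilies of a finite family of cells, so only finitely many
  exist.\<close>

lemma information_structure_finite:
  assumes "information_structure I"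
  shows "finite I"
proof (rule finite_subset)
  show "I \<subseteq> Union ` Pow platform_info"
    using assms by (auto simp: information_structure_def)
  show "finite (Union ` Pow platform_info)" by (simp add: platform_info_def)
qed

text \<open>Structures whose groups are single cells serve to realize the submenus of the menu of
  \<open>platform_info\<close>.\<close>

lemma information_structure_cells:
  assumes "S \<subseteq> platform_info" "S \<noteq> {}"
  shows "information_structure S"
proof -
  have "disjoint platform_info"
    unfolding platform_info_def using cells_disjoint by (rule disjoint_family_on_disjoint_image)
  then have "disjoint S" using assms(1) by (auto simp: disjoint_def)
  moreover have "B \<noteq> {} \<and> (\<exists>S\<subseteq>platform_info. B = \<Union>S)" if "B \<in> S" for B
    using that assms(1) cell_union_cell unfolding cell_union_def platform_info_def by blast
  ultimately show ?thesis using assms(2) by (simp add: information_structure_def)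
qed

text \<open>A cell is its own lowest cell. Hence each offer of a group is also the offer of an
  element of \<open>platform_info\<close>.\<close>

lemma lowest_offer_lowest_cell:
  assumes "cell_union B"
  shows "lowest_offer (lowest_cell B) = lowest_offer B"
  using lowest_cell_mem[OF assms] lowest_cell_cell
  by (auto simp: platform_info_def lowest_offer_def lowest_cost_def lowest_belief_def)

lemma all_menus_eq:
  assumes "C\<^sub>o \<in> menus platform_info"
  shows "all_menus = Pow C\<^sub>o - {{}}"
proof -
  have fin: "finite platform_info" by (simp add: platform_info_def)
  have cu: "cell_union B" if "B \<in> platform_info" for B
    using that cell_union_cell by (auto simp: platform_info_def)
  have Co: "C\<^sub>o = lowest_offer ` platform_info"
    using mem_menus_iff[OF fin cu] assms by blast
  show ?thesis
  proof (intro equalityI subsetI)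
    fix C assume "C \<in> all_menus"
    then obtain I where I: "information_structure I" "C \<in> menus I"
      by (auto simp: all_menus_def)
    note cuI = information_structure_cell_union[OF I(1)]
    have "C = lowest_offer ` I"
      using mem_menus_iff[OF information_structure_finite[OF I(1)] cuI] I(2) by blast
    moreover have "lowest_offer B \<in> C\<^sub>o" if "B \<in> I" for B
      unfolding Co using lowest_cell_mem[OF cuI[OF that]] lowest_offer_lowest_cell[OF cuI[OF that]]
      by (metis imageI)
    moreover have "I \<noteq> {}" using I(1) by (simp add: information_structure_def)
    ultimately show "C \<in> Pow C\<^sub>o - {{}}" by auto
  next
    fix C assume C: "C \<in> Pow C\<^sub>o - {{}}"
    \<comment> \<open>Keeping only cells that carry the offers in \<open>C\<close> gives the
      required structure; \<open>S\<close> is nonempty because \<open>C\<close> is.\<close>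
    then obtain S where S: "S \<subseteq> platform_info" "C = lowest_offer ` S"
      unfolding Co by (auto simp: subset_image_iff)
    then have info: "information_structure S"
      using C information_structure_cells by blast
    have "C \<in> menus S"
      unfolding S(2)
      by (rule submenu_mem_menus[OF fin information_structure_finite[OF info] cu
            information_structure_cell_union[OF info] assms image_mono[OF S(1)]])
    moreover then have "implementable S" by (auto simp: menus_def implementable_def)
    ultimately show "C \<in> all_menus" unfolding all_menus_def using info by blast
  qed
qed

end

section \<open>The three claims for a structure labelled by increasing cost\<close>

theorem theorem3:
  fixes xbar a b :: real
    and \<phi> :: "real measure"
    and l n :: nat
    and A B G :: "nat \<Rightarrow> real set"
    and c F :: "real \<Rightarrow> real"
    and I :: "real set set"
    and C :: "(real \<times> real) set"
  assumes "market xbar \<phi> l A c a b F"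
    and "market.information_structure l A I"
    and "I = B ` {1..n}"
    and "inj_on B {1..n}"
    and "\<And>j. j \<in> {1..n} \<Longrightarrow> G j = market.lowest_cell l A (B j)"
    and "strict_mono_on {1..n} (\<lambda>j. cell_cost c (G j))"
    and "C \<in> market.menus \<phi> c a b F I"
  shows "C = (\<lambda>j. (cell_cost c (G j), mean_quality (uniform_measure \<phi> (G j)))) ` {1..n} \<and>
         {(cell_cost c (G n), mean_quality (uniform_measure \<phi> (G n)))}
           \<in> market.menus \<phi> c a b F {B n} \<and>
         (\<forall>C\<^sub>o. market.implementable \<phi> c a b F (market.platform_info l A) \<and>
               C\<^sub>o \<in> market.menus \<phi> c a b F (market.platform_info l A) \<longrightarrow>
               market.all_menus \<phi> l A c a b F = Pow C\<^sub>o - {{}})"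
proof -
  interpret market xbar \<phi> l A c a b F by (rule assms(1))
  have cu: "\<And>B. B \<in> I \<Longrightarrow> cell_union B" and fin: "finite I"
    using information_structure_cell_union information_structure_finite assms(2) by auto
  have offer: "lowest_offer (B j) = (cell_cost c (G j), mean_quality (uniform_measure \<phi> (G j)))"
    if "j \<in> {1..n}" for j
    using assms(5)[OF that] by (simp add: lowest_offer_def lowest_cost_def lowest_belief_def)
  have "I \<noteq> {}" using assms(2) by (simp add: information_structure_def)
  \<comment> \<open>For \<open>n = 0\<close> the index set would be empty, contrary to
    \<open>I\<close> being nonempty; so \<open>B n\<close> really is a group.\<close>
  then have n: "n \<in> {1..n}" using assms(3) by (cases n) auto
  then have Bn: "B n \<in> I" using assms(3) by blast
  have "C = lowest_offer ` I" using mem_menus_iff[OF fin cu] assms(7) by blast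
  then have "C = (\<lambda>j. (cell_cost c (G j), mean_quality (uniform_measure \<phi> (G j)))) ` {1..n}"
    unfolding assms(3) image_image using offer by (auto intro!: image_cong)
  moreover have "lowest_offer ` {B n} \<in> menus {B n}"
    by (rule submenu_mem_menus[OF fin _ cu _ assms(7)]) (use Bn cu in auto)
  then have "{(cell_cost c (G n), mean_quality (uniform_measure \<phi> (G n)))} \<in> menus {B n}"
    using offer[OF n] by simp
  ultimately show ?thesis using all_menus_eq by blast
qed

end
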